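(* Let $G:\mathbb R^{n_x}\to\mathbb R^K$ be locally Lipschitz with constant $c_{\mathrm{lip}}>0$. Let $(u_0^{(j)})_{j=1,\dots,J}$ be a linearly independent initial ensemble in $\mathbb R^{n_x}$ and let $\mathcal S=\operatorname{span}\{u_0^{(j)}\mid j=1,\dots,J\}$ be its linear span. Then for all $T>0$ the TEKI flow $$\frac{\mathrm du_t^{(j)}}{\mathrm dt}=C^{u,G}(u_t)\Gamma^{-1}(y-G(u_t^{(j)}))-C(u_t)C_0^{-1}u_t^{(j)},\qquad j=1,\dots,J,$$ with initial ensemble $(u_0^{(j)})_{j=1,\dots,J}$ has a unique solution $(u_t^{(j)},t\in[0,T])\in C([0,T],\mathcal S)$, $j=1,\dots,J$. In particular, $\langle z,u_t^{(j)}\rangle=0$ for all $z\in\mathcal S^\perp$, all $t\in[0,T]$ and all $j=1,\dots,J$.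
   Context: Let $n_x,K,J\in\mathbb N$ with $J\ge2$, let $y\in\mathbb R^K$ be fixed, and let $\Gamma\in\mathbb R^{K\times K}$, $C_0\in\mathbb R^{n_x\times n_x}$ be symmetric positive definite. For an ensemble $u=(u^{(j)})_{j=1,\dots,J}$ in $\mathbb R^{n_x}$ put $\bar u=\frac1J\sum_{j}u^{(j)}$, $\bar G=\frac1J\sum_jG(u^{(j)})$, $C(u)=\frac1J\sum_j(u^{(j)}-\bar u)(u^{(j)}-\bar u)^\top$ and $C^{u,G}(u)=\frac1J\sum_j(u^{(j)}-\bar u)(G(u^{(j)})-\bar G)^\top$. *)

theory Defs
  imports "HOL-Analysis.Analysis"
begin

text \<open>An ensemble of \<open>J = CARD('j)\<close> particles in \<open>\<real>\<^sup>n\<close> is a vector \<open>u :: real^'n^'j\<close>;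
  its \<open>j\<close>-th particle is \<open>u $ j\<close>.\<close>

definition spd_matrix :: "real^'n^'n \<Rightarrow> bool" where
  "spd_matrix A \<longleftrightarrow> transpose A = A \<and> (\<forall>x. x \<noteq> 0 \<longrightarrow> x \<bullet> (A *v x) > 0)"

text \<open>A Lipschitz condition near every point, with one and the same constant \<open>c\<close> at all points.
  In \<^const>\<open>local_lipschitz\<close> the constant may depend on the point.\<close>

definition locally_lipschitz_const ::
    "real \<Rightarrow> ('a::metric_space \<Rightarrow> 'b::metric_space) \<Rightarrow> bool" where
  "locally_lipschitz_const c G \<longleftrightarrow> (\<forall>x. \<exists>r>0. c-lipschitz_on (ball x r) G)"

definition outer_product :: "real^'n \<Rightarrow> real^'k \<Rightarrow> real^'k^'n" where
  "outer_product v w = (\<chi> i l. v $ i * w $ l)"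

definition ensemble_mean :: "real^'n^'j \<Rightarrow> real^'n" where
  "ensemble_mean u = (1 / real CARD('j)) *\<^sub>R (\<Sum>j\<in>UNIV. u $ j)"

definition ensemble_map :: "(real^'n \<Rightarrow> real^'k) \<Rightarrow> real^'n^'j \<Rightarrow> real^'k^'j" where
  "ensemble_map G u = (\<chi> j. G (u $ j))"

definition cross_cov :: "real^'n^'j \<Rightarrow> real^'k^'j \<Rightarrow> real^'k^'n" where
  "cross_cov u w = (1 / real CARD('j)) *\<^sub>R
     (\<Sum>j\<in>UNIV. outer_product (u $ j - ensemble_mean u) (w $ j - ensemble_mean w))"

definition cov :: "real^'n^'j \<Rightarrow> real^'n^'n" where
  "cov u = cross_cov u u"

definition cov_uG :: "(real^'n \<Rightarrow> real^'k) \<Rightarrow> real^'n^'j \<Rightarrow> real^'k^'n" where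
  "cov_uG G u = cross_cov u (ensemble_map G u)"

definition teki_rhs ::
    "(real^'n \<Rightarrow> real^'k) \<Rightarrow> real^'k \<Rightarrow> real^'k^'k \<Rightarrow> real^'n^'n \<Rightarrow> real^'n^'j \<Rightarrow> 'j \<Rightarrow> real^'n" where
  "teki_rhs G y \<Gamma> C0 u j =
     cov_uG G u *v (matrix_inv \<Gamma> *v (y - G (u $ j))) - cov u *v (matrix_inv C0 *v (u $ j))"

text \<open>Classical solutions on \<open>[0,T]\<close>, with one-sided derivatives at the end points. Values of
  \<open>u\<close> outside \<open>[0,T]\<close> are irrelevant, and no particle is required to stay in a subspace.\<close>

definition teki_solution ::
    "(real^'n \<Rightarrow> real^'k) \<Rightarrow> real^'k \<Rightarrow> real^'k^'k \<Rightarrow> real^'n^'n \<Rightarrow> real^'n^'j \<Rightarrow> real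
      \<Rightarrow> (real \<Rightarrow> real^'n^'j) \<Rightarrow> bool" where
  "teki_solution G y \<Gamma> C0 u0 T u \<longleftrightarrow>
     u 0 = u0 \<and>
     (\<forall>j. \<forall>t\<in>{0..T}.
        ((\<lambda>s. u s $ j) has_vector_derivative teki_rhs G y \<Gamma> C0 (u t) j) (at t within {0..T}))"

end

theory Submission
  imports Defs
begin

text \<open>
  The flow is the autonomous equation \<open>u' = F u\<close> in the space of ensembles, and \<open>F\<close> is Lipschitz
  on every ball: a Lipschitz condition with one constant near every point is a global one (follow
  the segment between two points), and \<open>F\<close> is built from \<open>G\<close> and linear maps by sums and products.
  Uniqueness follows by Gronwall. As \<open>F\<close> grows cubically, existence up to time \<open>T\<close> needs an a priori
  bound.

  Write \<open>e\<^sub>j\<close> and \<open>g\<^sub>j\<close> for the deviations of \<open>u\<^sub>j\<close> and \<open>G (u\<^sub>j)\<close> from their ensemble means. Since the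
  \<open>e\<^sub>j\<close> sum to zero,
  \<open>\<Sum>\<^sub>j e\<^sub>j \<bullet> F\<^sub>j u = - (1/J) \<Sum>\<^sub>i\<^sub>j (e\<^sub>i \<bullet> e\<^sub>j) (g\<^sub>i \<bullet> \<Gamma>\<^sup>-\<^sup>1 g\<^sub>j + e\<^sub>i \<bullet> C\<^sub>0\<^sup>-\<^sup>1 e\<^sub>j) \<le> 0\<close>,
  so the spread \<open>\<Sum>\<^sub>j \<bar>e\<^sub>j\<bar>\<^sup>2\<close> does not increase (\<open>dev_inner_teki_field_le_0\<close>). On the set of ensembles
  whose spread is below a given bound the covariances are bounded, because \<open>G\<close> is Lipschitz, and \<open>F\<close>
  grows only linearly (\<open>teki_field_linear_growth\<close>); Gronwall then bounds \<open>u\<close> on \<open>[0,T]\<close>.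

  To turn this into existence, \<open>F\<close> is replaced by \<open>\<phi> F\<close> with a scalar cut-off \<open>0 \<le> \<phi> \<le> 1\<close> that is
  \<open>1\<close> on a large ball. This field is globally Lipschitz, so it has a solution on \<open>[0,T]\<close>. Both
  estimates above survive multiplication by \<open>\<phi>\<close> with the same constants, so the solution never leaves
  the ball where \<open>\<phi> = 1\<close> (\<open>ode_exists_of_apriori_bound\<close>).

  Finally, each \<open>F\<^sub>j u\<close> is a combination of the \<open>e\<^sub>i\<close>, so \<open>F\<close> maps the subspace of ensembles in \<open>S\<close>
  into itself, and such a subspace is invariant for a locally Lipschitz field
  (\<open>ode_subspace_invariant\<close>).
\<close>

section \<open>Ordinary differential equations\<close>

text \<open>Gronwall's inequality for the squared norm. The shift \<open>c\<close> allows for a constant term in the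
  differential inequality.\<close>

lemma gronwall_energy:
  fixes x x' :: "real \<Rightarrow> 'a::real_inner"
  assumes deriv: "\<And>t. t \<in> {0..T} \<Longrightarrow> (x has_vector_derivative x' t) (at t within {0..T})"
    and le: "\<And>t. t \<in> {0..T} \<Longrightarrow> 2 * (x t \<bullet> x' t) \<le> k * (c + x t \<bullet> x t)"
    and t: "t \<in> {0..T}"
  shows "c + x t \<bullet> x t \<le> exp (k * t) * (c + x 0 \<bullet> x 0)"
proof -
  define f where "f = (\<lambda>s. exp (- k * s) * (c + x s \<bullet> x s))"
  have f': "(f has_real_derivative exp (- k * s) * (2 * (x s \<bullet> x' s) - k * (c + x s \<bullet> x s)))
      (at s within {0..T})" if s: "s \<in> {0..T}" for s
  proof -
    have "((\<lambda>s. x s \<bullet> x s) has_vector_derivative x s \<bullet> x' s + x' s \<bullet> x s) (at s within {0..T})"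
      by (rule bounded_bilinear.has_vector_derivative[OF bounded_bilinear_inner deriv[OF s] deriv[OF s]])
    then have "((\<lambda>s. x s \<bullet> x s) has_real_derivative 2 * (x s \<bullet> x' s)) (at s within {0..T})"
      by (simp add: has_real_derivative_iff_has_vector_derivative inner_commute)
    then show ?thesis
      unfolding f_def by (auto intro!: derivative_eq_intros simp: algebra_simps)
  qed
  have "f t \<le> f 0"
  proof (rule DERIV_nonpos_imp_decreasing_open[where f = f and a = 0 and b = t])
    show "0 \<le> t" using t by simp
    show "continuous_on {0..t} f"
      using continuous_on_subset[OF DERIV_continuous_on[OF f'], of "{0..t}"] t by auto
    fix s assume s: "0 < s" "s < t"
    then have "at s within {0..T} = at s"
      using t by (intro at_within_interior) auto
    with f'[of s] s t
    have "(f has_real_derivative exp (- k * s) * (2 * (x s \<bullet> x' s) - k * (c + x s \<bullet> x s))) (at s)"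
      by auto
    moreover have "exp (- k * s) * (2 * (x s \<bullet> x' s) - k * (c + x s \<bullet> x s)) \<le> 0"
      using le[of s] s t by (intro mult_nonneg_nonpos) auto
    ultimately show "\<exists>y. (f has_real_derivative y) (at s) \<and> y \<le> 0" by blast
  qed
  then show ?thesis
    by (simp add: f_def exp_minus field_simps)
qed

lemma ode_unique:
  fixes F :: "'a::real_inner \<Rightarrow> 'a"
  assumes u: "\<And>t. t \<in> {0..T} \<Longrightarrow> (u has_vector_derivative F (u t)) (at t within {0..T})"
    and v: "\<And>t. t \<in> {0..T} \<Longrightarrow> (v has_vector_derivative F (v t)) (at t within {0..T})"
    and lip: "\<And>R. \<exists>L. L-lipschitz_on (cball 0 R) F"
    and "u 0 = v 0" and t: "t \<in> {0..T}"
  shows "u t = v t"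
proof -
  have "continuous_on {0..T} u" "continuous_on {0..T} v"
    using continuous_on_vector_derivative[OF u] continuous_on_vector_derivative[OF v] by auto
  then have "bounded (u ` {0..T} \<union> v ` {0..T})"
    by (auto intro!: compact_imp_bounded compact_continuous_image)
  then obtain R where "\<forall>x\<in>u ` {0..T} \<union> v ` {0..T}. norm x \<le> R"
    unfolding bounded_iff by blast
  then have R: "u s \<in> cball 0 R" "v s \<in> cball 0 R" if "s \<in> {0..T}" for s
    using that by auto
  obtain L where L: "L-lipschitz_on (cball 0 R) F" using lip by blast
  have "0 + (u t - v t) \<bullet> (u t - v t) \<le> exp ((2 * L) * t) * (0 + (u 0 - v 0) \<bullet> (u 0 - v 0))"
  proof (rule gronwall_energy)
    fix s assume s: "s \<in> {0..T}"
    show "((\<lambda>s. u s - v s) has_vector_derivative F (u s) - F (v s)) (at s within {0..T})"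
      using u v s by (auto intro!: derivative_intros)
    have "(u s - v s) \<bullet> (F (u s) - F (v s)) \<le> norm (u s - v s) * norm (F (u s) - F (v s))"
      by (rule norm_cauchy_schwarz)
    also have "\<dots> \<le> norm (u s - v s) * (L * norm (u s - v s))"
      by (intro mult_left_mono lipschitz_on_normD[OF L]) (use R s in auto)
    finally show "2 * ((u s - v s) \<bullet> (F (u s) - F (v s)))
        \<le> 2 * L * (0 + (u s - v s) \<bullet> (u s - v s))"
      by (simp add: dot_square_norm power2_eq_square algebra_simps)
  qed (rule t)
  then show ?thesis
    using \<open>u 0 = v 0\<close> by (simp add: dot_square_norm)
qed

text \<open>The Picard operator on \<open>[0,T]\<close> is a contraction for the norm weighted by \<open>exp (- k t)\<close> with
  \<open>k > 2 L\<close>, so one fixed point gives the solution for every \<open>T\<close>, without gluing short intervals. The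
  unknown of the fixed point equation is \<open>g t = exp (- k t) u t\<close>, for which the weighted norm is the
  supremum norm.\<close>

lemma lipschitz_ode_exists:
  fixes F :: "'a::banach \<Rightarrow> 'a"
  assumes lip: "L-lipschitz_on UNIV F" and T: "T \<ge> 0"
  obtains u where "u 0 = u0"
    "\<And>t. t \<in> {0..T} \<Longrightarrow> (u has_vector_derivative F (u t)) (at t within {0..T})"
proof -
  define k where "k = 2 * L + 1"
  have L: "L \<ge> 0" using lip by (rule lipschitz_on_nonneg)
  then have k: "k > 0" by (simp add: k_def)
  \<comment> \<open>Functions on \<open>[0,T]\<close> are extended by constants in order to use the complete space of bounded
    continuous functions on the whole line.\<close>
  define clip where "clip = (\<lambda>t. max 0 (min T t))"
  have clip: "clip t \<in> {0..T}" "continuous_on UNIV clip" for t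
    using T by (auto simp: clip_def intro!: continuous_intros)
  define I where "I = (\<lambda>(g :: real \<Rightarrow>\<^sub>C 'a) s. F (exp (k * s) *\<^sub>R g s))"
  define H where "H = (\<lambda>g t. exp (- k * t) *\<^sub>R (u0 + integral {0..t} (I g)))"
  have contF: "continuous_on UNIV F" using lip by (rule lipschitz_on_continuous_on)
  have contI: "continuous_on A (I g)" for A g
    unfolding I_def by (intro continuous_on_compose2[OF contF] continuous_intros) auto
  have intI: "I g integrable_on {0..t}" for g t
    by (rule integrable_continuous_real[OF contI])
  have contH: "continuous_on {0..T} (H g)" for g
    unfolding H_def
    by (intro continuous_intros indefinite_integral_continuous_1 intI)
  have inB: "(\<lambda>t. H g (clip t)) \<in> bcontfun" for g
  proof -
    have "continuous_on UNIV (\<lambda>t. H g (clip t))"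
      by (rule continuous_on_compose2[OF contH]) (use clip in auto)
    moreover have "bounded (H g ` {0..T})"
      by (intro compact_imp_bounded compact_continuous_image contH) auto
    then have "bounded (range (\<lambda>t. H g (clip t)))"
      by (rule bounded_subset) (use clip in auto)
    ultimately show ?thesis by (simp add: bcontfun_def)
  qed
  define \<Phi> where "\<Phi> = (\<lambda>g. Bcontfun (\<lambda>t. H g (clip t)))"
  have \<Phi>: "\<Phi> g t = H g (clip t)" for g t
    unfolding \<Phi>_def by (simp add: Bcontfun_inverse[OF inB])
  have H_le: "norm (H g t - H h t) \<le> (1/2) * dist g h" if t: "t \<in> {0..T}" for g h t
  proof -
    let ?d = "dist g h"
    have E: "((\<lambda>s. (L * ?d) * exp (k * s)) has_integral
        (L * ?d / k) * exp (k * t) - (L * ?d / k) * exp (k * 0)) {0..t}"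
    proof (rule fundamental_theorem_of_calculus)
      show "0 \<le> t" using t by simp
      show "((\<lambda>s. (L * ?d / k) * exp (k * s)) has_vector_derivative (L * ?d) * exp (k * s))
          (at s within {0..t})" for s
        unfolding has_real_derivative_iff_has_vector_derivative[symmetric]
        using k by (auto intro!: derivative_eq_intros)
    qed
    have "norm (integral {0..t} (\<lambda>s. I g s - I h s)) \<le> integral {0..t} (\<lambda>s. (L * ?d) * exp (k * s))"
    proof (rule integral_norm_bound_integral)
      show "(\<lambda>s. I g s - I h s) integrable_on {0..t}" by (intro integrable_diff intI)
      show "(\<lambda>s. (L * ?d) * exp (k * s)) integrable_on {0..t}" using E by blast
      fix s
      have "norm (I g s - I h s) \<le> L * norm (exp (k * s) *\<^sub>R g s - exp (k * s) *\<^sub>R h s)"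
        unfolding I_def by (rule lipschitz_on_normD[OF lip]) auto
      also have "\<dots> = L * (exp (k * s) * dist (g s) (h s))"
        by (simp add: dist_norm flip: scaleR_diff_right)
      also have "\<dots> \<le> L * (exp (k * s) * ?d)"
        by (intro mult_left_mono dist_bounded L) auto
      finally show "norm (I g s - I h s) \<le> (L * ?d) * exp (k * s)" by (simp add: mult_ac)
    qed
    also have "\<dots> = (L * ?d / k) * exp (k * t) - L * ?d / k"
      using integral_unique[OF E] by simp
    also have "\<dots> \<le> (L * ?d / k) * exp (k * t)" using L k by simp
    also have "\<dots> \<le> (1/2) * ?d * exp (k * t)"
      using L k by (intro mult_right_mono) (auto simp: k_def field_simps)
    finally have "norm (integral {0..t} (I g) - integral {0..t} (I h)) \<le> (1/2) * ?d * exp (k * t)"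
      by (simp add: Henstock_Kurzweil_Integration.integral_diff intI)
    moreover have "norm (H g t - H h t)
        = exp (- k * t) * norm (integral {0..t} (I g) - integral {0..t} (I h))"
      unfolding H_def by (simp flip: scaleR_diff_right)
    ultimately have "norm (H g t - H h t) \<le> exp (- k * t) * ((1/2) * ?d * exp (k * t))"
      by (simp add: mult_left_mono)
    also have "\<dots> = (1/2) * ?d" by (simp add: exp_minus)
    finally show ?thesis .
  qed
  have "\<exists>!g. \<Phi> g = g"
  proof (rule banach_fix_type[of "1/2"])
    show "\<forall>g h. dist (\<Phi> g) (\<Phi> h) \<le> 1/2 * dist g h"
      by (intro allI dist_bound) (use H_le clip in \<open>auto simp: \<Phi> dist_norm\<close>)
  qed auto
  then obtain g where g: "\<Phi> g = g" by blast
  have clip_id: "clip t = t" if "t \<in> {0..T}" for t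
    using that by (auto simp: clip_def)
  define u where "u = (\<lambda>t. exp (k * t) *\<^sub>R g t)"
  have u: "u t = u0 + integral {0..t} (\<lambda>s. F (u s))" if "t \<in> {0..T}" for t
  proof -
    have "u t = exp (k * t) *\<^sub>R H g t"
      using \<Phi>[of g t] by (simp add: g u_def clip_id[OF that])
    then show ?thesis by (simp add: H_def I_def u_def flip: exp_add)
  qed
  show ?thesis
  proof (rule that[of u])
    show "u 0 = u0" using u[of 0] T by simp
    fix t assume t: "t \<in> {0..T}"
    have "((\<lambda>t. u0 + integral {0..t} (\<lambda>s. F (u s))) has_vector_derivative 0 + F (u t)) (at t within {0..T})"
      using contI[of "{0..T}" g] t unfolding I_def u_def
      by (intro has_vector_derivative_add integral_has_vector_derivative) auto
    then show "(u has_vector_derivative F (u t)) (at t within {0..T})"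
      using has_vector_derivative_transform[OF t, of u] u by auto
  qed
qed

text \<open>The cut-off factor is \<open>1\<close> on the ball of radius \<open>R\<close> and vanishes outside the ball of radius
  \<open>R + 1\<close>.\<close>

lemma truncated_lipschitz:
  fixes F :: "'a::real_normed_vector \<Rightarrow> 'b::real_normed_vector"
  assumes lip: "L-lipschitz_on (cball 0 (R + 1)) F" and R: "R \<ge> 0"
  obtains M where "M-lipschitz_on UNIV (\<lambda>x. max 0 (min 1 (R + 1 - norm x)) *\<^sub>R F x)"
proof -
  define \<phi> where "\<phi> = (\<lambda>x::'a. max 0 (min 1 (R + 1 - norm x)))"
  have \<phi>: "0 \<le> \<phi> x" "\<phi> x \<le> 1" "\<bar>\<phi> x - \<phi> y\<bar> \<le> norm (x - y)" for x y :: 'a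
    using norm_triangle_ineq3[of x y] by (auto simp: \<phi>_def max_def min_def)
  have \<phi>0: "\<phi> x = 0" if "x \<notin> cball 0 (R + 1)" for x :: 'a
    using that by (auto simp: \<phi>_def)
  have L: "L \<ge> 0" using lip by (rule lipschitz_on_nonneg)
  define M where "M = norm (F 0) + L * (R + 1)"
  have M: "norm (F x) \<le> M" if "x \<in> cball 0 (R + 1)" for x
  proof -
    have "norm (F x) \<le> norm (F 0) + norm (F x - F 0)" by norm
    also have "norm (F x - F 0) \<le> L * norm (x - 0)"
      by (rule lipschitz_on_normD[OF lip that]) (use R in auto)
    also have "\<dots> \<le> L * (R + 1)" using that L by (intro mult_left_mono) auto
    finally show ?thesis by (simp add: M_def)
  qed
  have M0: "M \<ge> 0" using L R by (simp add: M_def)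
  have inside: "norm (\<phi> x *\<^sub>R F x - \<phi> y *\<^sub>R F y) \<le> (M + L) * norm (x - y)"
    if x: "x \<in> cball 0 (R + 1)" for x y
  proof -
    have "norm (\<phi> x *\<^sub>R F x - \<phi> y *\<^sub>R F y)
        = norm ((\<phi> x - \<phi> y) *\<^sub>R F x + \<phi> y *\<^sub>R (F x - F y))"
      by (simp add: algebra_simps)
    also have "\<dots> \<le> \<bar>\<phi> x - \<phi> y\<bar> * norm (F x) + \<phi> y * norm (F x - F y)"
      by (rule order_trans[OF norm_triangle_ineq]) (simp add: \<phi>)
    also have "\<bar>\<phi> x - \<phi> y\<bar> * norm (F x) \<le> norm (x - y) * M"
      by (intro mult_mono \<phi> M x) auto
    also have "\<phi> y * norm (F x - F y) \<le> L * norm (x - y)"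
    proof (cases "y \<in> cball 0 (R + 1)")
      case True
      have "\<phi> y * norm (F x - F y) \<le> 1 * (L * norm (x - y))"
        by (intro mult_mono \<phi> lipschitz_on_normD[OF lip x True]) auto
      then show ?thesis by simp
    qed (simp add: \<phi>0 L)
    finally show ?thesis by (simp add: algebra_simps)
  qed
  have "(M + L)-lipschitz_on UNIV (\<lambda>x. \<phi> x *\<^sub>R F x)"
  proof (rule lipschitz_onI)
    fix x y :: 'a
    consider "x \<in> cball 0 (R + 1)" | "y \<in> cball 0 (R + 1)"
      | "x \<notin> cball 0 (R + 1)" "y \<notin> cball 0 (R + 1)" by blast
    then show "dist (\<phi> x *\<^sub>R F x) (\<phi> y *\<^sub>R F y) \<le> (M + L) * dist x y"
    proof cases
      case 1 then show ?thesis using inside[of x y] by (simp add: dist_norm)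
    next
      case 2 then show ?thesis using inside[of y x] by (simp add: dist_norm norm_minus_commute)
    next
      case 3 then show ?thesis using L M0 by (simp add: \<phi>0)
    qed
  qed (use L M0 in simp)
  then show ?thesis using that by (simp add: \<phi>_def)
qed

text \<open>The a priori bound is required for all fields \<open>\<phi> F\<close> with \<open>0 \<le> \<phi> \<le> 1\<close>. For such a field any
  estimate obtained from \<open>x \<bullet> F x \<le> h x\<close> with \<open>h \<ge> 0\<close> remains valid, and a truncation \<open>\<phi> F\<close> is what
  can be solved globally.\<close>

lemma ode_exists_of_apriori_bound:
  fixes F :: "'a::banach \<Rightarrow> 'a"
  assumes lip: "\<And>R. \<exists>L. L-lipschitz_on (cball 0 R) F" and T: "T \<ge> 0" and R: "R \<ge> 0"
    and apriori: "\<And>\<phi> u t. (\<And>x. \<phi> x \<in> {0..1}) \<Longrightarrow> u 0 = u0 \<Longrightarrow>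
        (\<And>t. t \<in> {0..T} \<Longrightarrow> (u has_vector_derivative \<phi> (u t) *\<^sub>R F (u t)) (at t within {0..T})) \<Longrightarrow>
        t \<in> {0..T} \<Longrightarrow> norm (u t) \<le> R"
  obtains u where "u 0 = u0"
    "\<And>t. t \<in> {0..T} \<Longrightarrow> (u has_vector_derivative F (u t)) (at t within {0..T})"
proof -
  define \<phi> where "\<phi> = (\<lambda>x::'a. max 0 (min 1 (R + 1 - norm x)))"
  have \<phi>: "\<phi> x \<in> {0..1}" for x by (auto simp: \<phi>_def)
  obtain M where "M-lipschitz_on UNIV (\<lambda>x. \<phi> x *\<^sub>R F x)"
    using truncated_lipschitz[OF _ R, of _ F] lip[of "R + 1"] unfolding \<phi>_def by metis
  from lipschitz_ode_exists[OF this T, of u0]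
  obtain u where u0: "u 0 = u0" and
    u: "\<And>t. t \<in> {0..T} \<Longrightarrow> (u has_vector_derivative \<phi> (u t) *\<^sub>R F (u t)) (at t within {0..T})"
    by blast
  have "norm (u t) \<le> R" if "t \<in> {0..T}" for t
    using apriori[OF \<phi> u0 u that] .
  then have "\<phi> (u t) = 1" if "t \<in> {0..T}" for t
    using that by (fastforce simp: \<phi>_def)
  with u u0 that[of u] show ?thesis by simp
qed

text \<open>Let \<open>P\<close> be the orthogonal projection onto \<open>W\<close>, and let \<open>Q x = x - P x\<close>. As \<open>F (P x)\<close> lies in
  \<open>W\<close>, it is orthogonal to \<open>Q x\<close>, so that \<open>Q x \<bullet> F x = Q x \<bullet> (F x - F (P x)) \<le> L \<bar>Q x\<bar>\<^sup>2\<close>, and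
  Gronwall applies to \<open>Q u\<close>.\<close>

lemma ode_subspace_invariant:
  fixes F :: "'a::euclidean_space \<Rightarrow> 'a"
  assumes lip: "\<And>R. \<exists>L. L-lipschitz_on (cball 0 R) F"
    and W: "subspace W" and inv: "\<And>x. x \<in> W \<Longrightarrow> F x \<in> W"
    and u: "\<And>t. t \<in> {0..T} \<Longrightarrow> (u has_vector_derivative F (u t)) (at t within {0..T})"
    and u0: "u 0 \<in> W" and t: "t \<in> {0..T}"
  shows "u t \<in> W"
proof -
  obtain B where B: "B \<subseteq> W" "pairwise orthogonal B" "\<And>b. b \<in> B \<Longrightarrow> norm b = 1"
    "independent B" "span B = W"
    using orthonormal_basis_subspace[OF W] by metis
  have finB: "finite B" using B(4) by (rule independent_imp_finite)
  define P where "P = (\<lambda>x. \<Sum>b\<in>B. (b \<bullet> x) *\<^sub>R b)"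
  define Q where "Q = (\<lambda>x. x - P x)"
  have PQ: "x - P x = Q x" for x by (simp add: Q_def)
  have PW: "P x \<in> W" for x
    unfolding P_def by (intro subspace_sum[OF W] subspace_scale[OF W]) (use B in auto)
  have QB: "b \<bullet> Q x = 0" if "b \<in> B" for b x
  proof -
    have "b \<bullet> P x = (\<Sum>c\<in>B. (c \<bullet> x) * (b \<bullet> c))" by (simp add: P_def inner_sum_right)
    also have "\<dots> = (\<Sum>c\<in>B. if c = b then b \<bullet> x else 0)"
      using B(2,3) that
      by (intro sum.cong) (auto simp: pairwise_def orthogonal_def dot_square_norm)
    also have "\<dots> = b \<bullet> x" using finB that by simp
    finally show ?thesis by (simp add: Q_def inner_diff_right)
  qed
  have QW: "w \<bullet> Q x = 0" if "w \<in> W" for w x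
  proof -
    have "orthogonal (Q x) w"
      by (rule orthogonal_to_span[of w B]) (use that B(5) QB in \<open>auto simp: orthogonal_def inner_commute\<close>)
    then show ?thesis by (simp add: orthogonal_def inner_commute)
  qed
  have P_id: "P x = x" if "x \<in> W" for x
  proof -
    have "x - P x \<in> W" using that PW by (intro subspace_diff W)
    from QW[OF this, of x] show ?thesis by (simp add: Q_def)
  qed
  have normP: "norm (P x) \<le> norm x" for x
  proof -
    have "norm (P x)^2 = P x \<bullet> x"
      using QW[OF PW, of x x] by (simp add: Q_def dot_square_norm inner_diff_right)
    also have "\<dots> \<le> norm (P x) * norm x" by (rule norm_cauchy_schwarz)
    finally show ?thesis
      by (metis mult_le_cancel_left_pos norm_ge_zero norm_le_zero_iff not_le order.trans power2_eq_square)
  qed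
  have Q: "bounded_linear Q"
    unfolding Q_def P_def
    by (intro bounded_linear_intros)
  have "continuous_on {0..T} u"
    using u by (rule continuous_on_vector_derivative)
  then have "bounded (u ` {0..T})"
    by (auto intro!: compact_imp_bounded compact_continuous_image)
  then obtain R where R: "\<And>t. t \<in> {0..T} \<Longrightarrow> norm (u t) \<le> R"
    unfolding bounded_iff by blast
  obtain L where L: "L-lipschitz_on (cball 0 R) F" using lip by blast
  have "0 + Q (u t) \<bullet> Q (u t) \<le> exp ((2 * L) * t) * (0 + Q (u 0) \<bullet> Q (u 0))"
  proof (rule gronwall_energy)
    fix s assume s: "s \<in> {0..T}"
    show "((\<lambda>s. Q (u s)) has_vector_derivative Q (F (u s))) (at s within {0..T})"
      by (rule bounded_linear.has_vector_derivative[OF Q u[OF s]])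
    have "Q (u s) \<bullet> Q (F (u s)) = Q (u s) \<bullet> (F (u s) - F (P (u s)))"
      using QW[OF PW, of "F (u s)" "u s"] QW[OF inv[OF PW], of "u s" "u s"]
      by (simp add: Q_def inner_diff_right inner_commute)
    also have "\<dots> \<le> norm (Q (u s)) * norm (F (u s) - F (P (u s)))"
      by (rule norm_cauchy_schwarz)
    also have "\<dots> \<le> norm (Q (u s)) * (L * norm (u s - P (u s)))"
      using R[OF s] normP[of "u s"]
      by (intro mult_left_mono lipschitz_on_normD[OF L]) auto
    finally show "2 * (Q (u s) \<bullet> Q (F (u s))) \<le> 2 * L * (0 + Q (u s) \<bullet> Q (u s))"
      by (simp add: dot_square_norm power2_eq_square mult_ac PQ)
  qed (rule t)
  moreover have "Q (u 0) = 0" using P_id[OF u0] by (simp add: Q_def)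
  ultimately have "Q (u t) = 0" by (simp add: dot_square_norm)
  then show ?thesis using PW[of "u t"] by (simp add: Q_def)
qed

section \<open>Maps that are Lipschitz on balls\<close>

text \<open>The Lipschitz constant may depend on the radius. It is enough to consider balls around the
  origin.\<close>

definition lipschitz_on_balls :: "('a::real_normed_vector \<Rightarrow> 'b::metric_space) \<Rightarrow> bool" where
  "lipschitz_on_balls f \<longleftrightarrow> (\<forall>R. \<exists>L. L-lipschitz_on (cball 0 R) f)"

lemma lipschitz_on_balls_linear: "bounded_linear f \<Longrightarrow> lipschitz_on_balls f"
  unfolding lipschitz_on_balls_def by (metis bounded_linear.lipschitz_boundE)

lemma lipschitz_on_balls_const: "lipschitz_on_balls (\<lambda>x. c)"
  unfolding lipschitz_on_balls_def using lipschitz_on_constant by blast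

lemma lipschitz_on_balls_comp:
  assumes "L-lipschitz_on UNIV g" "lipschitz_on_balls f"
  shows "lipschitz_on_balls (\<lambda>x. g (f x))"
  unfolding lipschitz_on_balls_def
proof
  fix R
  obtain M where "M-lipschitz_on (cball 0 R) f"
    using assms(2) unfolding lipschitz_on_balls_def by blast
  then have "(L * M)-lipschitz_on (cball 0 R) (\<lambda>x. g (f x))"
    by (rule lipschitz_on_compose2) (use assms(1) lipschitz_on_subset in blast)
  then show "\<exists>L. L-lipschitz_on (cball 0 R) (\<lambda>x. g (f x))" by blast
qed

lemma lipschitz_on_balls_comp_linear:
  assumes "bounded_linear g" "lipschitz_on_balls f"
  shows "lipschitz_on_balls (\<lambda>x. g (f x))"
  using assms lipschitz_on_balls_comp by (metis bounded_linear.lipschitz_boundE)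

lemma lipschitz_on_balls_diff:
  fixes f g :: "'a::real_normed_vector \<Rightarrow> 'b::real_normed_vector"
  assumes "lipschitz_on_balls f" "lipschitz_on_balls g"
  shows "lipschitz_on_balls (\<lambda>x. f x - g x)"
  using assms unfolding lipschitz_on_balls_def by (metis lipschitz_on_diff)

lemma lipschitz_on_balls_sum:
  fixes f :: "'i \<Rightarrow> 'a::real_normed_vector \<Rightarrow> 'b::real_normed_vector"
  assumes "\<And>i. lipschitz_on_balls (f i)"
  shows "lipschitz_on_balls (\<lambda>x. \<Sum>i\<in>I. f i x)"
proof (induction I rule: infinite_finite_induct)
  case (insert i I)
  then show ?case
    using assms[of i] unfolding lipschitz_on_balls_def by simp (metis lipschitz_on_add)
qed (simp_all add: lipschitz_on_balls_const)

lemma lipschitz_on_balls_vec: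
  fixes f :: "'a::real_normed_vector \<Rightarrow> 'j::finite \<Rightarrow> 'b::real_normed_vector"
  assumes "\<And>j. lipschitz_on_balls (\<lambda>x. f x j)"
  shows "lipschitz_on_balls (\<lambda>x. \<chi> j. f x j)"
  unfolding lipschitz_on_balls_def
proof
  fix R
  have "\<forall>j. \<exists>L. L-lipschitz_on (cball 0 R) (\<lambda>x. f x j)"
    using assms unfolding lipschitz_on_balls_def by blast
  then obtain L where L: "\<And>j. (L j)-lipschitz_on (cball 0 R) (\<lambda>x. f x j)" by metis
  have "(\<Sum>j\<in>UNIV. L j)-lipschitz_on (cball 0 R) (\<lambda>x. \<chi> j. f x j)"
  proof (rule lipschitz_onI)
    fix x y :: 'a assume xy: "x \<in> cball 0 R" "y \<in> cball 0 R"
    have "dist (\<chi> j. f x j) (\<chi> j. f y j) \<le> (\<Sum>j\<in>UNIV. dist (f x j) (f y j))"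
      unfolding dist_vec_def by (rule order_trans[OF L2_set_le_sum]) auto
    also have "\<dots> \<le> (\<Sum>j\<in>UNIV. L j * dist x y)"
      by (intro sum_mono lipschitz_onD[OF L] xy)
    finally show "dist (\<chi> j. f x j) (\<chi> j. f y j) \<le> (\<Sum>j\<in>UNIV. L j) * dist x y"
      by (simp add: sum_distrib_right)
  qed (auto intro!: sum_nonneg lipschitz_on_nonneg[OF L])
  then show "\<exists>L. L-lipschitz_on (cball 0 R) (\<lambda>x. \<chi> j. f x j)" by blast
qed

lemma lipschitz_on_balls_bounded:
  fixes f :: "'a::real_normed_vector \<Rightarrow> 'b::real_normed_vector"
  assumes "lipschitz_on_balls f"
  obtains B where "B \<ge> 0" "\<And>x. x \<in> cball 0 R \<Longrightarrow> norm (f x) \<le> B"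
proof -
  obtain L where L: "L-lipschitz_on (cball 0 \<bar>R\<bar>) f"
    using assms unfolding lipschitz_on_balls_def by blast
  have L0: "L \<ge> 0" using L by (rule lipschitz_on_nonneg)
  have "norm (f x) \<le> norm (f 0) + L * \<bar>R\<bar>" if "x \<in> cball 0 R" for x
  proof -
    have "norm (f x) \<le> norm (f 0) + norm (f x - f 0)" by norm
    also have "norm (f x - f 0) \<le> L * norm (x - 0)"
      by (rule lipschitz_on_normD[OF L]) (use that in auto)
    also have "\<dots> \<le> L * \<bar>R\<bar>" using that L0 by (intro mult_left_mono) auto
    finally show ?thesis by simp
  qed
  then show ?thesis using L0 by (intro that[of "norm (f 0) + L * \<bar>R\<bar>"]) auto
qed

lemma lipschitz_on_balls_bilinear:
  fixes f :: "'a::real_normed_vector \<Rightarrow> 'b::real_normed_vector"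
    and g :: "'a::real_normed_vector \<Rightarrow> 'c::real_normed_vector"
  assumes "bounded_bilinear h" "lipschitz_on_balls f" "lipschitz_on_balls g"
  shows "lipschitz_on_balls (\<lambda>x. h (f x) (g x))"
  unfolding lipschitz_on_balls_def
proof
  fix R
  interpret h: bounded_bilinear h by fact
  obtain K where K: "K \<ge> 0" "\<And>a b. norm (h a b) \<le> norm a * norm b * K"
    using h.nonneg_bounded by blast
  obtain A B where A: "A \<ge> 0" "\<And>x. x \<in> cball 0 R \<Longrightarrow> norm (f x) \<le> A"
    and B: "B \<ge> 0" "\<And>x. x \<in> cball 0 R \<Longrightarrow> norm (g x) \<le> B"
    using lipschitz_on_balls_bounded assms(2,3) by metis
  obtain L M where L: "L-lipschitz_on (cball 0 R) f" and M: "M-lipschitz_on (cball 0 R) g"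
    using assms(2,3) unfolding lipschitz_on_balls_def by blast
  have nn: "L \<ge> 0" "M \<ge> 0" using L M lipschitz_on_nonneg by auto
  have "(L * B * K + A * M * K)-lipschitz_on (cball 0 R) (\<lambda>x. h (f x) (g x))"
  proof (rule lipschitz_onI)
    fix x y :: 'a assume xy: "x \<in> cball 0 R" "y \<in> cball 0 R"
    have "norm (h (f x) (g x) - h (f y) (g y)) = norm (h (f x - f y) (g x) + h (f y) (g x - g y))"
      by (simp add: h.diff_left h.diff_right)
    also have "\<dots> \<le> norm (f x - f y) * norm (g x) * K + norm (f y) * norm (g x - g y) * K"
      by (intro norm_triangle_le add_mono K)
    also have "\<dots> \<le> (L * norm (x - y)) * B * K + A * (M * norm (x - y)) * K"
      using A B K(1) nn xy
      by (intro add_mono mult_right_mono mult_mono lipschitz_on_normD[OF L] lipschitz_on_normD[OF M]) auto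
    finally show "dist (h (f x) (g x)) (h (f y) (g y)) \<le> (L * B * K + A * M * K) * dist x y"
      by (simp add: dist_norm algebra_simps)
  qed (use A B K(1) nn in auto)
  then show "\<exists>L. L-lipschitz_on (cball 0 R) (\<lambda>x. h (f x) (g x))" by blast
qed

text \<open>With one constant at all points, the local condition propagates along the segment from \<open>x\<close> to
  \<open>y\<close>.\<close>

lemma locally_lipschitz_const_imp_lipschitz:
  fixes G :: "'a::real_normed_vector \<Rightarrow> 'b::metric_space"
  assumes G: "locally_lipschitz_const c G" and c: "c \<ge> 0"
  shows "c-lipschitz_on UNIV G"
proof (rule lipschitz_onI)
  fix x y :: 'a
  define p where "p = (\<lambda>t::real. x + t *\<^sub>R (y - x))"
  have dp: "dist (p s) (p t) = \<bar>s - t\<bar> * dist x y" for s t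
    by (simp add: p_def dist_norm norm_minus_commute flip: scaleR_diff_left)
  have contp: "continuous_on A p" for A unfolding p_def by (intro continuous_intros)
  have contG: "continuous_on UNIV G"
    unfolding continuous_on_eq_continuous_at[OF open_UNIV]
  proof
    fix z
    obtain r where "r > 0" "c-lipschitz_on (ball z r) G"
      using G unfolding locally_lipschitz_const_def by blast
    then show "isCont G z"
      using lipschitz_on_continuous_on continuous_on_eq_continuous_at[OF open_ball] centre_in_ball
      by blast
  qed
  have "(c * dist x y)-lipschitz_on {0..1} (\<lambda>t. G (p t))"
  proof (rule locally_lipschitz_imp_lipschitz)
    show "continuous_on {0..1} (\<lambda>t. G (p t))"
      by (rule continuous_on_compose2[OF contG contp]) auto
    fix s t :: real assume st: "s \<in> {0..<1}" "s < t"
    obtain r where r: "r > 0" "c-lipschitz_on (ball (p s) r) G"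
      using G unfolding locally_lipschitz_const_def by blast
    \<comment> \<open>The \<open>+ 1\<close> keeps the denominator positive when \<open>x = y\<close>.\<close>
    define z where "z = min t (s + r / (dist x y + 1))"
    have d: "dist x y + 1 > 0" using zero_le_dist[of x y] by linarith
    have z: "z \<in> {s<..t}" using st r d by (auto simp: z_def)
    have "(z - s) * dist x y < (z - s) * (dist x y + 1)" using z by simp
    also have "\<dots> \<le> (r / (dist x y + 1)) * (dist x y + 1)"
      using d by (intro mult_right_mono) (auto simp: z_def)
    also have "\<dots> = r" using d by simp
    finally have "p z \<in> ball (p s) r" using dp[of s z] z by simp
    then have "dist (G (p z)) (G (p s)) \<le> c * dist (p z) (p s)"
      using r by (intro lipschitz_onD[OF r(2)]) auto
    then have "dist (G (p z)) (G (p s)) \<le> c * dist x y * (z - s)"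
      using z by (simp add: dp mult_ac)
    with z show "\<exists>z\<in>{s<..t}. dist (G (p z)) (G (p s)) \<le> c * dist x y * (z - s)" by blast
  qed (use c in simp)
  from lipschitz_onD[OF this, of 0 1] show "dist (G x) (G y) \<le> c * dist x y"
    by (simp add: p_def)
qed (rule c)

section \<open>Positive semidefinite forms and means\<close>

lemma mean_norm_le:
  fixes f :: "'j::finite \<Rightarrow> 'a::real_normed_vector"
  assumes "\<And>i. norm (f i) \<le> X"
  shows "norm ((1 / real CARD('j)) *\<^sub>R (\<Sum>i\<in>UNIV. f i)) \<le> X"
proof -
  have "norm (\<Sum>i\<in>UNIV. f i) \<le> real CARD('j) * X"
    by (rule sum_norm_bound) (use assms in auto)
  then show ?thesis by (simp add: field_simps)
qed

text \<open>The Hadamard product of the Gram matrix of the \<open>e\<^sub>i\<close> with the matrix of the values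
  \<open>g\<^sub>i \<bullet> M g\<^sub>j\<close> has a nonnegative sum of entries: expanding \<open>e\<^sub>i \<bullet> e\<^sub>j\<close> in coordinates turns the double
  sum into \<open>\<Sum>\<^sub>b h\<^sub>b \<bullet> M h\<^sub>b\<close> with \<open>h\<^sub>b = \<Sum>\<^sub>i (e\<^sub>i \<bullet> b) g\<^sub>i\<close>. Symmetry of \<open>M\<close> is not needed.\<close>

lemma sum_inner_psd_nonneg:
  fixes e :: "'i \<Rightarrow> 'a::euclidean_space" and g :: "'i \<Rightarrow> 'b::real_inner"
  assumes M: "linear M" and psd: "\<And>x. x \<bullet> M x \<ge> 0"
  shows "(\<Sum>i\<in>I. \<Sum>j\<in>I. (e i \<bullet> e j) * (g i \<bullet> M (g j))) \<ge> 0"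
proof -
  define h where "h = (\<lambda>b. \<Sum>i\<in>I. (e i \<bullet> b) *\<^sub>R g i)"
  have "(\<Sum>i\<in>I. \<Sum>j\<in>I. (e i \<bullet> e j) * (g i \<bullet> M (g j)))
      = (\<Sum>i\<in>I. \<Sum>j\<in>I. \<Sum>b\<in>Basis. (e i \<bullet> b) * (e j \<bullet> b) * (g i \<bullet> M (g j)))"
    by (subst euclidean_inner) (simp add: sum_distrib_right)
  also have "\<dots> = (\<Sum>b\<in>Basis. \<Sum>i\<in>I. \<Sum>j\<in>I. (e i \<bullet> b) * (e j \<bullet> b) * (g i \<bullet> M (g j)))"
    by (subst sum.swap, rule sum.cong[OF refl], subst sum.swap, rule refl) 
  also have "\<dots> = (\<Sum>b\<in>Basis. h b \<bullet> M (h b))"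
    unfolding h_def
    by (simp add: linear_sum[OF M] linear_scale[OF M] inner_sum_left inner_sum_right sum_distrib_left mult_ac)
      (rule sum.cong[OF refl], subst sum.swap, simp add: mult_ac)
  also have "\<dots> \<ge> 0" by (intro sum_nonneg psd)
  finally show ?thesis .
qed

lemma spd_matrix_inv_psd:
  assumes "spd_matrix A"
  shows "x \<bullet> (matrix_inv A *v x) \<ge> 0"
proof -
  have "invertible A"
    unfolding invertible_left_inverse matrix_left_invertible_ker
    using assms unfolding spd_matrix_def by (metis inner_zero_right less_irrefl)
  then have "A ** matrix_inv A = mat 1" 
    unfolding invertible_def matrix_inv_def by (metis (mono_tags, lifting) someI_ex)
  then have x: "A *v (matrix_inv A *v x) = x" by (simp add: matrix_vector_mul_assoc)
  have "(matrix_inv A *v x) \<bullet> (A *v (matrix_inv A *v x)) \<ge> 0"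
    using assms unfolding spd_matrix_def by (metis inner_zero_left less_eq_real_def)
  then show ?thesis by (simp add: x inner_commute)
qed

section \<open>Deviations from the ensemble mean\<close>

text \<open>The ensemble of deviations from the mean; \<open>dev\<close> is the orthogonal projection onto the ensembles
  with mean zero.\<close>

definition dev :: "real^'n^'j \<Rightarrow> real^'n^'j" where
  "dev u = (\<chi> j. u $ j - ensemble_mean u)"

lemma bounded_linear_dev: "bounded_linear dev"
proof -
  have "linear dev"
    by (rule linearI)
      (simp_all add: dev_def ensemble_mean_def vec_eq_iff sum.distrib algebra_simps flip: scaleR_sum_right)
  then show ?thesis by (rule linear_conv_bounded_linear[THEN iffD1])
qed

lemma sum_dev: "(\<Sum>j\<in>UNIV. dev u $ j) = 0"
  by (simp add: dev_def ensemble_mean_def sum_subtractf sum_constant_scaleR del: sum_constant)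

lemma inner_dev_const: "dev u \<bullet> (\<chi> j. v) = 0"
  by (simp add: inner_vec_def[of "dev u"] flip: inner_sum_left, simp add: sum_dev)

lemma dev_split: "u = dev u + (\<chi> j. ensemble_mean u)"
  by (simp add: dev_def vec_eq_iff)

lemma inner_dev_dev: "dev u \<bullet> dev v = dev u \<bullet> v"
  by (subst (2) dev_split[of v]) (simp add: inner_add_right inner_dev_const)

lemma cross_cov_mult:
  fixes u :: "real^'n^'j" and w :: "real^'k^'j"
  shows "cross_cov u w *v x
    = (1 / real CARD('j)) *\<^sub>R (\<Sum>i\<in>UNIV. (dev w $ i \<bullet> x) *\<^sub>R dev u $ i)"
proof -
  have lin: "linear (\<lambda>A::real^'k^'n. A *v x)"
    by (rule linearI) (simp_all add: matrix_vector_mult_add_rdistrib scaleR_matrix_vector_assoc)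
  have outer: "outer_product v z *v x = (z \<bullet> x) *\<^sub>R v" for v :: "real^'n" and z :: "real^'k"
    by (simp add: outer_product_def matrix_vector_mult_def vec_eq_iff inner_vec_def
        sum_distrib_left mult_ac)
  show ?thesis
    unfolding cross_cov_def by (simp add: linear_scale[OF lin] linear_sum[OF lin] outer dev_def)
qed

section \<open>Derivatives of ensembles\<close>

lemma has_vector_derivative_vec_iff:
  fixes f :: "real \<Rightarrow> 'a::real_normed_vector ^ 'j"
  shows "(f has_vector_derivative f') (at t within A) \<longleftrightarrow>
    (\<forall>j. ((\<lambda>s. f s $ j) has_vector_derivative f' $ j) (at t within A))"
proof
  assume "(f has_vector_derivative f') (at t within A)"
  then show "\<forall>j. ((\<lambda>s. f s $ j) has_vector_derivative f' $ j) (at t within A)"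
    by (auto intro: bounded_linear.has_vector_derivative[OF bounded_linear_vec_nth])
next
  assume *: "\<forall>j. ((\<lambda>s. f s $ j) has_vector_derivative f' $ j) (at t within A)"
  show "(f has_vector_derivative f') (at t within A)"
    unfolding has_vector_derivative_def has_derivative_within
  proof (intro conjI vec_tendstoI)
    show "bounded_linear (\<lambda>x. x *\<^sub>R f')" by (rule bounded_linear_scaleR_left)
    show "((\<lambda>s. ((1 / norm (s - t)) *\<^sub>R (f s - (f t + (s - t) *\<^sub>R f'))) $ j) \<longlongrightarrow> 0 $ j) (at t within A)" for j
      using * by (simp add: has_vector_derivative_def has_derivative_within)
  qed
qed

section \<open>The vector field of the flow\<close>

text \<open>The right hand sides of all particles, collected into one vector field on the space of
  ensembles.\<close>

definition teki_field ::
    "(real^'n \<Rightarrow> real^'k) \<Rightarrow> real^'k \<Rightarrow> real^'k^'k \<Rightarrow> real^'n^'n \<Rightarrow> real^'n^'j \<Rightarrow> real^'n^'j" where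
  "teki_field G y \<Gamma> C0 u = (\<chi> j. teki_rhs G y \<Gamma> C0 u j)"

lemma teki_solution_iff:
  "teki_solution G y \<Gamma> C0 u0 T u \<longleftrightarrow> u 0 = u0 \<and>
    (\<forall>t\<in>{0..T}. (u has_vector_derivative teki_field G y \<Gamma> C0 (u t)) (at t within {0..T}))"
  unfolding teki_solution_def has_vector_derivative_vec_iff by (auto simp: teki_field_def)

text \<open>The right hand side is a linear combination of the deviations, which is the source of both the
  energy estimate and the invariance of the span.\<close>

lemma teki_rhs_eq:
  fixes u :: "real^'n^'j"
  shows "teki_rhs G y \<Gamma> C0 u j
    = (1 / real CARD('j)) *\<^sub>R (\<Sum>i\<in>UNIV.
        (dev (ensemble_map G u) $ i \<bullet> (matrix_inv \<Gamma> *v (y - G (u $ j))) -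
         dev u $ i \<bullet> (matrix_inv C0 *v (u $ j))) *\<^sub>R dev u $ i)"
  unfolding teki_rhs_def cov_uG_def cov_def cross_cov_mult
  by (simp add: scaleR_diff_left sum_subtractf scaleR_diff_right)

lemma teki_field_lipschitz_on_balls:
  assumes G: "c-lipschitz_on UNIV G"
  shows "lipschitz_on_balls (teki_field G y \<Gamma> C0 :: real^'n^'j \<Rightarrow> real^'n^'j)"
proof -
  have comp: "lipschitz_on_balls (\<lambda>u::real^'n^'j. u $ j)" for j
    by (intro lipschitz_on_balls_linear bounded_linear_vec_nth)
  have Gj: "lipschitz_on_balls (\<lambda>u::real^'n^'j. G (u $ j))" for j
    by (intro lipschitz_on_balls_comp[OF G] comp)
  have nth_dev: "bounded_linear (\<lambda>x::real^'m^'j. dev x $ i)" for i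
    by (rule bounded_linear_compose[OF bounded_linear_vec_nth bounded_linear_dev])
  have devG: "lipschitz_on_balls (\<lambda>u::real^'n^'j. dev (ensemble_map G u) $ i)" for i
    unfolding ensemble_map_def
    by (intro lipschitz_on_balls_comp_linear[OF nth_dev] lipschitz_on_balls_vec Gj)
  show ?thesis
    unfolding teki_field_def teki_rhs_eq
    by (intro lipschitz_on_balls_vec lipschitz_on_balls_sum devG Gj comp
        lipschitz_on_balls_comp_linear[OF bounded_linear_scaleR_right]
        lipschitz_on_balls_bilinear[OF bounded_bilinear_scaleR]
        lipschitz_on_balls_bilinear[OF bounded_bilinear_inner]
        lipschitz_on_balls_comp_linear[OF matrix_vector_mul_bounded_linear]
        lipschitz_on_balls_diff lipschitz_on_balls_const lipschitz_on_balls_linear[OF nth_dev])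
qed

text \<open>The spread of the ensemble does not increase along the flow.\<close>

lemma dev_inner_teki_field_le_0:
  fixes u :: "real^'n^'j"
  assumes \<Gamma>: "\<And>x. x \<bullet> (matrix_inv \<Gamma> *v x) \<ge> 0" and C0: "\<And>x. x \<bullet> (matrix_inv C0 *v x) \<ge> 0"
  shows "dev u \<bullet> teki_field G y \<Gamma> C0 u \<le> 0"
proof -
  define g where "g = dev (ensemble_map G u)"
  define e where "e = dev u"
  define m where "m = ensemble_mean (ensemble_map G u)"
  \<comment> \<open>The part of the coefficient of \<open>e\<^sub>i\<close> in \<open>J F\<^sub>j u\<close> that does not depend on \<open>j\<close>. It drops out
    because the deviations sum to zero.\<close>
  define D where "D = (\<lambda>i. g $ i \<bullet> (matrix_inv \<Gamma> *v (y - m)) - e $ i \<bullet> (matrix_inv C0 *v ensemble_mean u))"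
  have split: "g $ i \<bullet> (matrix_inv \<Gamma> *v (y - G (u $ j))) - e $ i \<bullet> (matrix_inv C0 *v (u $ j))
      = D i - g $ i \<bullet> (matrix_inv \<Gamma> *v (g $ j)) - e $ i \<bullet> (matrix_inv C0 *v (e $ j))" for i j
  proof -
    have "y - G (u $ j) = (y - m) - g $ j" "u $ j = ensemble_mean u + e $ j"
      by (simp_all add: g_def m_def e_def dev_def ensemble_map_def)
    then show ?thesis
      by (simp only: matrix_vector_mult_diff_distrib matrix_vector_right_distrib
          inner_diff_right inner_add_right D_def)
  qed
  have *: "(\<Sum>j\<in>UNIV. \<Sum>i\<in>UNIV. D i * (e $ j \<bullet> e $ i)) = 0"
    by (subst sum.swap) (simp add: sum_dev[of u] e_def flip: sum_distrib_left inner_sum_left)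
  have "e \<bullet> teki_field G y \<Gamma> C0 u = (\<Sum>j\<in>UNIV. e $ j \<bullet> teki_rhs G y \<Gamma> C0 u j)"
    by (simp add: inner_vec_def[of e] teki_field_def)
  also have "\<dots> = (\<Sum>j\<in>UNIV. (1 / real CARD('j)) * (\<Sum>i\<in>UNIV.
      (g $ i \<bullet> (matrix_inv \<Gamma> *v (y - G (u $ j))) - e $ i \<bullet> (matrix_inv C0 *v (u $ j))) * (e $ j \<bullet> e $ i)))"
    unfolding teki_rhs_eq by (simp add: inner_sum_right g_def e_def)
  also have "\<dots> = (1 / real CARD('j)) * (\<Sum>j\<in>UNIV. \<Sum>i\<in>UNIV.
      (D i - g $ i \<bullet> (matrix_inv \<Gamma> *v (g $ j)) - e $ i \<bullet> (matrix_inv C0 *v (e $ j))) * (e $ j \<bullet> e $ i))"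
    unfolding split by (simp add: sum_distrib_left)
  also have "(\<Sum>j\<in>UNIV. \<Sum>i\<in>UNIV.
      (D i - g $ i \<bullet> (matrix_inv \<Gamma> *v (g $ j)) - e $ i \<bullet> (matrix_inv C0 *v (e $ j))) * (e $ j \<bullet> e $ i))
    = - (\<Sum>i\<in>UNIV. \<Sum>j\<in>UNIV. (e $ i \<bullet> e $ j) * (g $ i \<bullet> (matrix_inv \<Gamma> *v (g $ j))))
      - (\<Sum>i\<in>UNIV. \<Sum>j\<in>UNIV. (e $ i \<bullet> e $ j) * (e $ i \<bullet> (matrix_inv C0 *v (e $ j))))"
    unfolding left_diff_distrib sum_subtractf *
    by (subst (1 2) sum.swap) (simp add: inner_commute[of "e $ _" "e $ _"] mult_ac)
  also have "(1 / real CARD('j)) * \<dots> \<le> 0"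
    using sum_inner_psd_nonneg[OF matrix_vector_mul_linear \<Gamma>, where e = "\<lambda>i. e $ i" and g = "\<lambda>i. g $ i" and I = UNIV]
      sum_inner_psd_nonneg[OF matrix_vector_mul_linear C0, where e = "\<lambda>i. e $ i" and g = "\<lambda>i. e $ i" and I = UNIV]
    by (intro mult_nonneg_nonpos) auto
  finally show ?thesis by (simp add: e_def)
qed

section \<open>The a priori bound\<close>

lemma norm_dev_nth_le:
  fixes w :: "real^'k^'j"
  assumes "\<And>i k. norm (w $ i - w $ k) \<le> X"
  shows "norm (dev w $ i) \<le> X"
proof -
  have "dev w $ i = (1 / real CARD('j)) *\<^sub>R (\<Sum>k\<in>UNIV. w $ i - w $ k)"
    by (simp add: dev_def ensemble_mean_def sum_subtractf sum_constant_scaleR scaleR_diff_right del: sum_constant)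
  then show ?thesis using mean_norm_le[of "\<lambda>k. w $ i - w $ k" X] assms by simp
qed

lemma teki_field_linear_growth:
  fixes G :: "real^'n \<Rightarrow> real^'k"
  assumes G: "c-lipschitz_on UNIV G" and \<rho>: "\<rho> \<ge> 0"
  obtains a b where "a \<ge> 0" "b \<ge> 0"
    "\<And>u::real^'n^'j. norm (dev u) \<le> \<rho> \<Longrightarrow> norm (teki_field G y \<Gamma> C0 u) \<le> a + b * norm u"
proof -
  have c: "c \<ge> 0" using G by (rule lipschitz_on_nonneg)
  obtain p where p: "p > 0" "\<And>x. norm (matrix_inv \<Gamma> *v x) \<le> norm x * p"
    using bounded_linear.pos_bounded[OF matrix_vector_mul_bounded_linear] by blast
  obtain q where q: "q > 0" "\<And>x. norm (matrix_inv C0 *v x) \<le> norm x * q"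
    using bounded_linear.pos_bounded[OF matrix_vector_mul_bounded_linear] by blast
  define J where "J = real CARD('j)"
  define a where "a = J * (2 * c * \<rho> * ((norm y + norm (G 0)) * p) * \<rho>)"
  define b where "b = J * ((2 * c * \<rho> * (c * p) + \<rho> * q) * \<rho>)"
  have "norm (teki_field G y \<Gamma> C0 u) \<le> a + b * norm u" if u: "norm (dev u) \<le> \<rho>" for u :: "real^'n^'j"
  proof -
    have e: "norm (dev u $ i) \<le> \<rho>" for i
      using Finite_Cartesian_Product.norm_nth_le[of "dev u" i] u by linarith
    have g: "norm (dev (ensemble_map G u) $ i) \<le> 2 * c * \<rho>" for i
    proof (rule norm_dev_nth_le)
      fix i k
      have "norm (G (u $ i) - G (u $ k)) \<le> c * norm (u $ i - u $ k)"
        by (rule lipschitz_on_normD[OF G]) auto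
      also have "u $ i - u $ k = dev u $ i - dev u $ k" by (simp add: dev_def)
      also have "c * norm (dev u $ i - dev u $ k) \<le> c * (\<rho> + \<rho>)"
        using c e by (intro mult_left_mono order_trans[OF norm_triangle_ineq4] add_mono) auto
      finally show "norm (ensemble_map G u $ i - ensemble_map G u $ k) \<le> 2 * c * \<rho>"
        by (simp add: ensemble_map_def algebra_simps)
    qed
    have "norm (teki_rhs G y \<Gamma> C0 u j)
        \<le> (2 * c * \<rho> * ((norm y + norm (G 0) + c * norm u) * p) + \<rho> * (norm u * q)) * \<rho>" for j
      unfolding teki_rhs_eq
    proof (rule mean_norm_le)
      fix i
      have uj: "norm (u $ j) \<le> norm u" by (rule Finite_Cartesian_Product.norm_nth_le)
      have "norm (y - G (u $ j)) \<le> norm y + norm (G 0) + norm (G (u $ j) - G 0)" by norm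
      also have "norm (G (u $ j) - G 0) \<le> c * norm (u $ j - 0)"
        by (rule lipschitz_on_normD[OF G]) auto
      also have "\<dots> \<le> c * norm u" using uj c by (simp add: mult_left_mono)
      finally have yG: "norm (y - G (u $ j)) \<le> norm y + norm (G 0) + c * norm u" by simp
      have "\<bar>dev (ensemble_map G u) $ i \<bullet> (matrix_inv \<Gamma> *v (y - G (u $ j)))\<bar>
          \<le> norm (dev (ensemble_map G u) $ i) * norm (matrix_inv \<Gamma> *v (y - G (u $ j)))"
        by (rule Cauchy_Schwarz_ineq2)
      also have "\<dots> \<le> 2 * c * \<rho> * ((norm y + norm (G 0) + c * norm u) * p)"
        using yG p(1) c \<rho>
        by (intro mult_mono g order_trans[OF p(2)] mult_right_mono) auto
      finally have 1: "\<bar>dev (ensemble_map G u) $ i \<bullet> (matrix_inv \<Gamma> *v (y - G (u $ j)))\<bar>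
          \<le> 2 * c * \<rho> * ((norm y + norm (G 0) + c * norm u) * p)" .
      have "\<bar>dev u $ i \<bullet> (matrix_inv C0 *v (u $ j))\<bar> \<le> norm (dev u $ i) * norm (matrix_inv C0 *v (u $ j))"
        by (rule Cauchy_Schwarz_ineq2)
      also have "\<dots> \<le> \<rho> * (norm u * q)"
        using uj q(1) \<rho>
        by (intro mult_mono e order_trans[OF q(2)] mult_right_mono) auto
      finally have 2: "\<bar>dev u $ i \<bullet> (matrix_inv C0 *v (u $ j))\<bar> \<le> \<rho> * (norm u * q)" .
      show "norm ((dev (ensemble_map G u) $ i \<bullet> (matrix_inv \<Gamma> *v (y - G (u $ j))) -
           dev u $ i \<bullet> (matrix_inv C0 *v (u $ j))) *\<^sub>R dev u $ i)
        \<le> (2 * c * \<rho> * ((norm y + norm (G 0) + c * norm u) * p) + \<rho> * (norm u * q)) * \<rho>"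
        unfolding norm_scaleR
        using 1 2 c \<rho> p(1) q(1) by (intro mult_mono e) (auto intro!: add_nonneg_nonneg mult_nonneg_nonneg)
    qed
    then have "(\<Sum>j\<in>UNIV. norm (teki_rhs G y \<Gamma> C0 u j))
        \<le> J * ((2 * c * \<rho> * ((norm y + norm (G 0) + c * norm u) * p) + \<rho> * (norm u * q)) * \<rho>)"
      unfolding J_def by (intro sum_bounded_above) auto
    moreover have "norm (teki_field G y \<Gamma> C0 u) \<le> (\<Sum>j\<in>UNIV. norm (teki_rhs G y \<Gamma> C0 u j))"
      unfolding norm_vec_def teki_field_def by (rule order_trans[OF L2_set_le_sum]) auto
    ultimately show ?thesis by (simp add: a_def b_def algebra_simps)
  qed
  moreover have "a \<ge> 0" "b \<ge> 0"
    unfolding a_def b_def J_def using c \<rho> p(1) q(1) by auto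
  ultimately show ?thesis using that by blast
qed

text \<open>The factor \<open>\<phi>\<close> does no harm: it preserves the sign in the estimate of the spread and only
  lowers the norm of the field in the growth estimate. The bound does not depend on \<open>\<phi>\<close>.\<close>

lemma teki_apriori_bound:
  fixes G :: "real^'n \<Rightarrow> real^'k" and u0 :: "real^'n^'j"
  assumes \<Gamma>: "\<And>x. x \<bullet> (matrix_inv \<Gamma> *v x) \<ge> 0" and C0: "\<And>x. x \<bullet> (matrix_inv C0 *v x) \<ge> 0"
    and G: "c-lipschitz_on UNIV G"
  obtains R where "R \<ge> 0"
    "\<And>\<phi> u t. (\<And>x. \<phi> x \<in> {0..1}) \<Longrightarrow> u 0 = u0 \<Longrightarrow>
        (\<And>t. t \<in> {0..T} \<Longrightarrow>
          (u has_vector_derivative \<phi> (u t) *\<^sub>R teki_field G y \<Gamma> C0 (u t)) (at t within {0..T})) \<Longrightarrow>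
        t \<in> {0..T} \<Longrightarrow> norm (u t) \<le> R"
proof -
  let ?F = "teki_field G y \<Gamma> C0 :: real^'n^'j \<Rightarrow> real^'n^'j"
  obtain a b where ab: "a \<ge> 0" "b \<ge> 0"
    "\<And>u::real^'n^'j. norm (dev u) \<le> norm (dev u0) \<Longrightarrow> norm (?F u) \<le> a + b * norm u"
    using teki_field_linear_growth[OF G norm_ge_zero] by blast
  define R where "R = exp ((a + 2 * b) * T) * (1 + u0 \<bullet> u0)"
  show ?thesis
  proof (rule that[of R])
    show "R \<ge> 0" by (simp add: R_def add_nonneg_nonneg)
    fix \<phi> :: "real^'n^'j \<Rightarrow> real" and u t
    assume \<phi>: "\<And>x. \<phi> x \<in> {0..1}" and u0: "u 0 = u0" and t: "t \<in> {0..T}"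
      and u: "\<And>t. t \<in> {0..T} \<Longrightarrow> (u has_vector_derivative \<phi> (u t) *\<^sub>R ?F (u t)) (at t within {0..T})"
    have dev_le: "norm (dev (u s)) \<le> norm (dev u0)" if s: "s \<in> {0..T}" for s
    proof -
      have "0 + dev (u s) \<bullet> dev (u s) \<le> exp (0 * s) * (0 + dev (u 0) \<bullet> dev (u 0))"
      proof (rule gronwall_energy[OF _ _ s])
        fix r assume r: "r \<in> {0..T}"
        show "((\<lambda>r. dev (u r)) has_vector_derivative dev (\<phi> (u r) *\<^sub>R ?F (u r))) (at r within {0..T})"
          by (rule bounded_linear.has_vector_derivative[OF bounded_linear_dev u[OF r]])
        have "\<phi> (u r) * (dev (u r) \<bullet> ?F (u r)) \<le> 0"
          using \<phi>[of "u r"] dev_inner_teki_field_le_0[OF \<Gamma> C0] by (intro mult_nonneg_nonpos) auto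
        then show "2 * (dev (u r) \<bullet> dev (\<phi> (u r) *\<^sub>R ?F (u r))) \<le> 0 * (0 + dev (u r) \<bullet> dev (u r))"
          by (simp add: inner_dev_dev)
      qed
      then show ?thesis by (simp add: u0 norm_le)
    qed
    have "1 + u t \<bullet> u t \<le> exp ((a + 2 * b) * t) * (1 + u 0 \<bullet> u 0)"
    proof (rule gronwall_energy[OF u _ t])
      fix s assume s: "s \<in> {0..T}"
      let ?n = "norm (u s)"
      have "u s \<bullet> (\<phi> (u s) *\<^sub>R ?F (u s)) \<le> norm (u s) * norm (\<phi> (u s) *\<^sub>R ?F (u s))"
        by (rule norm_cauchy_schwarz)
      also have "\<dots> \<le> ?n * (1 * (a + b * ?n))"
        unfolding norm_scaleR using \<phi>[of "u s"] ab(3)[OF dev_le[OF s]]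
        by (intro mult_left_mono mult_mono) auto
      finally have "2 * (u s \<bullet> (\<phi> (u s) *\<^sub>R ?F (u s))) \<le> a * (2 * ?n) + 2 * b * ?n^2"
        by (simp add: algebra_simps power2_eq_square)
      \<comment> \<open>\<open>2 r \<le> 1 + r\<^sup>2\<close>\<close>
      also have "\<dots> \<le> a * (1 + ?n^2) + 2 * b * (1 + ?n^2)"
        using ab(1,2) sum_squares_ge_zero[of "?n - 1" 0]
        by (intro add_mono mult_left_mono) (auto simp: power2_eq_square algebra_simps)
      finally show "2 * (u s \<bullet> (\<phi> (u s) *\<^sub>R ?F (u s))) \<le> (a + 2 * b) * (1 + u s \<bullet> u s)"
        by (simp add: dot_square_norm algebra_simps)
    qed
    also have "\<dots> \<le> R"
      unfolding R_def u0 using ab(1,2) t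
      by (intro mult_right_mono) (auto intro!: mult_left_mono add_nonneg_nonneg)
    finally have "1 + norm (u t)^2 \<le> R" by (simp add: dot_square_norm)
    moreover have "norm (u t) \<le> 1 + norm (u t)^2"
      using sum_squares_ge_zero[of "norm (u t) - 1" "norm (u t)"]
      by (simp add: power2_eq_square algebra_simps)
    ultimately show "norm (u t) \<le> R" by linarith
  qed
qed

section \<open>Well-posedness and invariance of the span\<close>

lemma teki_rhs_in_subspace:
  assumes S: "subspace S" and u: "\<And>j. u $ j \<in> S"
  shows "teki_rhs G y \<Gamma> C0 u j \<in> S"
proof -
  have "ensemble_mean u \<in> S"
    unfolding ensemble_mean_def by (intro subspace_scale[OF S] subspace_sum[OF S] u)
  then have "dev u $ i \<in> S" for i
    unfolding dev_def using subspace_diff[OF S u] by simp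
  then show ?thesis
    unfolding teki_rhs_eq by (intro subspace_scale[OF S] subspace_sum[OF S])
qed

theorem theorem4p1:
  fixes G :: "real^'n \<Rightarrow> real^'k"
    and y :: "real^'k"
    and \<Gamma> :: "real^'k^'k"
    and C0 :: "real^'n^'n"
    and u0 :: "real^'n^'j"
    and S :: "(real^'n) set"
    and c_lip T :: real
  assumes "CARD('j) \<ge> 2"
    and "spd_matrix \<Gamma>" and "spd_matrix C0"
    and "c_lip > 0" and "locally_lipschitz_const c_lip G"
    and "inj (\<lambda>j. u0 $ j)" and "independent (range (\<lambda>j. u0 $ j))"
    and "S = span (range (\<lambda>j. u0 $ j))"
    and "T > 0"
  shows "(\<exists>u. teki_solution G y \<Gamma> C0 u0 T u \<and>
            (\<forall>j. continuous_on {0..T} (\<lambda>t. u t $ j) \<and> (\<forall>t\<in>{0..T}. u t $ j \<in> S)) \<and>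
            (\<forall>v. teki_solution G y \<Gamma> C0 u0 T v \<longrightarrow> (\<forall>t\<in>{0..T}. v t = u t))) \<and>
         (\<forall>u. teki_solution G y \<Gamma> C0 u0 T u \<longrightarrow>
            (\<forall>z\<in>S\<^sup>\<bottom>. \<forall>t\<in>{0..T}. \<forall>j. z \<bullet> (u t $ j) = 0))"
proof -
  let ?F = "teki_field G y \<Gamma> C0 :: real^'n^'j \<Rightarrow> real^'n^'j"
  have G: "c_lip-lipschitz_on UNIV G"
    using assms(4,5) by (intro locally_lipschitz_const_imp_lipschitz) auto
  have lip: "\<exists>L. L-lipschitz_on (cball 0 R) ?F" for R
    using teki_field_lipschitz_on_balls[OF G] unfolding lipschitz_on_balls_def by blast
  have inS: "u t $ j \<in> S" if u: "teki_solution G y \<Gamma> C0 u0 T u" and t: "t \<in> {0..T}" for u t j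
  proof -
    have S: "subspace S" by (simp add: assms(8))
    have "u t \<in> {x. \<forall>j. x $ j \<in> S}"
    proof (rule ode_subspace_invariant[OF lip])
      show "subspace {x. \<forall>j. x $ j \<in> S}"
        using S by (auto simp: subspace_def)
      show "?F x \<in> {x. \<forall>j. x $ j \<in> S}" if "x \<in> {x. \<forall>j. x $ j \<in> S}" for x
        using that by (auto simp: teki_field_def intro!: teki_rhs_in_subspace[OF S])
      show "u 0 \<in> {x. \<forall>j. x $ j \<in> S}"
        using u by (auto simp: teki_solution_iff assms(8) intro: span_base)
    qed (use u t in \<open>auto simp: teki_solution_iff\<close>)
    then show ?thesis by simp
  qed
  have "\<exists>u. u 0 = u0 \<and> (\<forall>t\<in>{0..T}. (u has_vector_derivative ?F (u t)) (at t within {0..T}))"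
  proof (rule teki_apriori_bound[OF spd_matrix_inv_psd[OF assms(2)] spd_matrix_inv_psd[OF assms(3)] G])
    fix R
    assume R: "R \<ge> 0" and apriori:
      "\<And>\<phi> u t. (\<And>x. \<phi> x \<in> {0..1}) \<Longrightarrow> u 0 = u0 \<Longrightarrow>
        (\<And>t. t \<in> {0..T} \<Longrightarrow> (u has_vector_derivative \<phi> (u t) *\<^sub>R ?F (u t)) (at t within {0..T})) \<Longrightarrow>
        t \<in> {0..T} \<Longrightarrow> norm (u t) \<le> R"
    show ?thesis
    proof (rule ode_exists_of_apriori_bound[of ?F T R u0])
      show "\<exists>L. L-lipschitz_on (cball 0 R) ?F" for R by (rule lip)
      show "0 \<le> T" using assms(9) by simp
      show "norm (u t) \<le> R"
        if "\<And>x. \<phi> x \<in> {0..1}" "u 0 = u0"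
          "\<And>t. t \<in> {0..T} \<Longrightarrow> (u has_vector_derivative \<phi> (u t) *\<^sub>R ?F (u t)) (at t within {0..T})"
          "t \<in> {0..T}" for \<phi> u t
        by (rule apriori[of \<phi> u t, OF that])
    qed (use R in auto)
  qed
  then obtain u where "u 0 = u0"
    and u': "\<And>t. t \<in> {0..T} \<Longrightarrow> (u has_vector_derivative ?F (u t)) (at t within {0..T})"
    by blast
  then have u: "teki_solution G y \<Gamma> C0 u0 T u" by (simp add: teki_solution_iff)
  have "continuous_on {0..T} (\<lambda>t. u t $ j)" for j
    by (intro continuous_on_component continuous_on_vector_derivative[OF u'])
  moreover have "v t = u t" if "teki_solution G y \<Gamma> C0 u0 T v" "t \<in> {0..T}" for v t
    by (rule ode_unique[OF _ u' lip _ that(2)])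
      (use that(1) \<open>u 0 = u0\<close> in \<open>auto simp: teki_solution_iff\<close>)
  moreover have "z \<bullet> (v t $ j) = 0"
    if "teki_solution G y \<Gamma> C0 u0 T v" "z \<in> S\<^sup>\<bottom>" "t \<in> {0..T}" for v z t j
    using inS[OF that(1,3)] that(2)
    by (auto simp: orthogonal_comp_def orthogonal_def inner_commute)
  ultimately show ?thesis using u inS by blast
qed

end
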